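(* Let $d\in\{2,3\}$, $\mathcal{M}\subset\mathbb{R}^d$, and let $w_1,\dots,w_n$ be the softmax weights of a fixed directional basis $\mathcal{D}\subset\mathbb{S}^{d-1}$ and temperature $\varepsilon>0$. Suppose the environment signals $f_{\mathbf{p}}:\mathbb{S}^{d-1}\to\mathbb{R}$, $\mathbf{p}\in\mathcal{M}$, satisfy: (D1) for $\sigma$-almost every $\boldsymbol\theta\in\mathbb{S}^{d-1}$, the map $\mathbf{p}\mapsto f_{\mathbf{p}}(\boldsymbol\theta)$ is differentiable on $\mathcal{M}$ with gradient $\nabla_{\mathbf{p}}f_{\mathbf{p}}(\boldsymbol\theta)\in\mathbb{R}^d$; (D2) there exists $h\in L^1(\mathbb{S}^{d-1})$ such that $\|\nabla_{\mathbf{p}}f_{\mathbf{p}}(\boldsymbol\theta)\|_2\le h(\boldsymbol\theta)$ for all $\mathbf{p}\in\mathcal{M}$ and $\sigma$-a.e. $\boldsymbol\theta$. Then for every $i=1,\dots,n$, the map $\mathbf{p}\mapsto\phi_i(\mathbf{p})$ is Fréchet differentiable on $\mathcal{M}$ with $$\nabla_{\mathbf{p}}\phi_i(\mathbf{p})=\int_{\mathbb{S}^{d-1}}\nabla_{\mathbf{p}}f_{\mathbf{p}}(\boldsymbol\theta)\,w_i(\boldsymbol\theta)\,\mathrm{d}\sigma(\boldsymbol\theta)\in\mathbb{R}^d .$$ Consequently $\mathbf{F}:\mathcal{M}\to\mathbb{R}^n$ is Fréchet differentiable and its Jacobian $J_{\mathbf{F}}(\mathbf{p})\in\mathbb{R}^{n\times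 d}$ is $$J_{\mathbf{F}}(\mathbf{p})=\int_{\mathbb{S}^{d-1}}\mathbf{w}(\boldsymbol\theta)\,\nabla_{\mathbf{p}}f_{\mathbf{p}}(\boldsymbol\theta)^{\top}\,\mathrm{d}\sigma(\boldsymbol\theta),\qquad \mathbf{w}(\boldsymbol\theta)=[w_1(\boldsymbol\theta),\dots,w_n(\boldsymbol\theta)]^\top .$$
   Context: $\mathbb{S}^{d-1}$ is the unit sphere of $\mathbb{R}^d$ with standard surface measure $\sigma$. The softmax weights of a directional basis (finite set of unit vectors) $\{\mathbf{d}_1,\dots,\mathbf{d}_n\}$ and temperature $\varepsilon>0$ are $$w_i(\boldsymbol\theta)=\frac{\exp(\boldsymbol\theta^{\top}\mathbf{d}_i/\varepsilon)}{\sum_{j=1}^n\exp(\boldsymbol\theta^{\top}\mathbf{d}_j/\varepsilon)};$$ they do not depend on $\mathbf{p}$. The feature components are $\phi_i(\mathbf{p})=\int_{\mathbb{S}^{d-1}}f_{\mathbf{p}}w_i\,\mathrm{d}\sigma$ (each $f_{\mathbf{p}}$ being integrable, so that these are defined), and $\mathbf{F}(\mathbf{p})=[\phi_1(\mathbf{p}),\dots,\phi_n(\mathbf{p})]^\top$.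
   Formalization: The set M is assumed open: the gradient of p ↦ f_p(θ) at a point of M is otherwise undefined, and with derivatives taken relative to an arbitrary M the claim is false (e.g. for M a sequence together with its limit). *)

theory Defs
  imports "HOL-Analysis.Analysis"
begin

text \<open>
  Surface measure of the unit sphere, by polar coordinates: a Borel set \<open>A\<close> of directions has
  measure \<open>d\<close> times the Lebesgue measure of the cone \<open>{x. 0 < norm x < 1 \<and> x / norm x \<in> A}\<close>.
  The measure is completed because the gradient of the signal is determined only almost everywhere
  in \<open>\<theta>\<close>: without completion it could fail to be measurable, and the Bochner integral of a
  non-measurable function is \<open>0\<close> by convention.
\<close>

definition sphere_measure :: "'a::euclidean_space measure" where
  "sphere_measure = completion (scale_measure (ennreal (real DIM('a)))
     (distr (restrict_space lborel (ball 0 1 - {0})) (restrict_space borel (sphere 0 1))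
        (\<lambda>x. x /\<^sub>R norm x)))"

lemma space_sphere_measure: "space sphere_measure = sphere 0 1"
  by (simp add: sphere_measure_def space_scale_measure space_restrict_space)

lemma emeasure_sphere_measure:
  fixes A :: "'a::euclidean_space set"
  assumes "A \<in> sets borel" and "A \<subseteq> sphere 0 1"
  shows "emeasure sphere_measure A =
    ennreal (real DIM('a)) * emeasure lborel {x. 0 < norm x \<and> norm x < 1 \<and> x /\<^sub>R norm x \<in> A}"
proof -
  let ?B = "ball (0::'a) 1 - {0}"
  let ?u = "\<lambda>x::'a. x /\<^sub>R norm x"
  have A: "A \<in> sets (restrict_space borel (sphere 0 1))"
    using assms by (simp add: sets_restrict_space_iff)
  have u: "?u \<in> measurable (restrict_space lborel ?B) (restrict_space borel (sphere 0 1))"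
    by (rule measurable_restrict_space2)
       (auto simp: space_restrict_space intro!: measurable_restrict_space1)
  have eq: "?u -` A \<inter> space (restrict_space lborel ?B) =
      {x. 0 < norm x \<and> norm x < 1 \<and> ?u x \<in> A}"
    by (auto simp: space_restrict_space)
  have "emeasure (restrict_space lborel ?B) {x. 0 < norm x \<and> norm x < 1 \<and> ?u x \<in> A} =
      emeasure lborel {x. 0 < norm x \<and> norm x < 1 \<and> ?u x \<in> A}"
    by (rule emeasure_restrict_space) auto
  then have "emeasure (distr (restrict_space lborel ?B) (restrict_space borel (sphere 0 1)) ?u) A =
      emeasure lborel {x. 0 < norm x \<and> norm x < 1 \<and> ?u x \<in> A}"
    unfolding emeasure_distr[OF u A] eq .
  then show ?thesis
    unfolding sphere_measure_def using A by simp
qed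

text \<open>A directional basis \<open>{d\<^sub>1, \<dots>, d\<^sub>n}\<close> is enumerated without repetition by a finite index type.\<close>

definition directional_basis :: "('n::finite \<Rightarrow> 'a::euclidean_space) \<Rightarrow> bool" where
  "directional_basis D \<longleftrightarrow> inj D \<and> range D \<subseteq> sphere 0 1"

definition softmax_weight ::
  "('n::finite \<Rightarrow> 'a::euclidean_space) \<Rightarrow> real \<Rightarrow> 'n \<Rightarrow> 'a \<Rightarrow> real" where
  "softmax_weight D \<epsilon> i \<theta> =
     exp ((\<theta> \<bullet> D i) / \<epsilon>) / (\<Sum>j\<in>UNIV. exp ((\<theta> \<bullet> D j) / \<epsilon>))"

definition softmax_weights ::
  "('n::finite \<Rightarrow> 'a::euclidean_space) \<Rightarrow> real \<Rightarrow> 'a \<Rightarrow> real ^ 'n" where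
  "softmax_weights D \<epsilon> \<theta> = (\<chi> i. softmax_weight D \<epsilon> i \<theta>)"

definition feature_component ::
  "('n::finite \<Rightarrow> 'a::euclidean_space) \<Rightarrow> real \<Rightarrow> ('a \<Rightarrow> 'a \<Rightarrow> real) \<Rightarrow> 'n \<Rightarrow> 'a \<Rightarrow> real" where
  "feature_component D \<epsilon> f i p = (LINT \<theta>|sphere_measure. f p \<theta> * softmax_weight D \<epsilon> i \<theta>)"

definition feature_map ::
  "('n::finite \<Rightarrow> 'a::euclidean_space) \<Rightarrow> real \<Rightarrow> ('a \<Rightarrow> 'a \<Rightarrow> real) \<Rightarrow> 'a \<Rightarrow> real ^ 'n" where
  "feature_map D \<epsilon> f p = (\<chi> i. feature_component D \<epsilon> f i p)"

text \<open>The matrix \<open>w v\<^sup>T\<close>.\<close>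

definition outer_product :: "real ^ 'n \<Rightarrow> real ^ 'd \<Rightarrow> real ^ 'd ^ 'n" where
  "outer_product w v = (\<chi> i j. w $ i * v $ j)"

end

theory Submission
  imports Defs
begin

text \<open>
  The difference quotients of \<open>f\<close> at \<open>p\<close> are dominated by \<open>h\<close>, so dominated convergence along
  sequences \<open>q\<^sub>n \<longlonglongrightarrow> p\<close> gives the derivative of the integral. The mean value theorem does not yield
  this domination, because the null set in (D2) depends on the point: on the segment from \<open>p\<close> to \<open>q\<close>
  the gradient bound is known, for almost every \<open>\<theta>\<close>, only at almost every point (Fubini). That
  suffices, since a function differentiable everywhere on an interval is the Henstock--Kurzweil
  integral of its derivative, and null sets do not affect that integral. Completeness of the measure
  makes the gradient, an almost everywhere limit of difference quotients, measurable.
\<close>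

section \<open>Increments under an almost everywhere bound on the derivative\<close>

text \<open>Rounding the first argument down to a multiple of \<open>1 / Suc n\<close> leaves
  countably many values, so the rounded functions are jointly measurable; continuity in
  \<open>t\<close> makes them converge pointwise to \<open>G\<close>. Fubini's theorem will require
  this joint measurability.\<close>

lemma borel_measurable_Caratheodory:
  fixes G :: "real \<Rightarrow> 'b \<Rightarrow> 'c::metric_space"
  assumes cont: "\<And>y. y \<in> space N \<Longrightarrow> continuous_on UNIV (\<lambda>t. G t y)"
    and meas: "\<And>t. G t \<in> borel_measurable N"
  shows "(\<lambda>x. G (fst x) (snd x)) \<in> borel_measurable (lborel \<Otimes>\<^sub>M N)"
proof (rule borel_measurable_LIMSEQ_metric)
  fix n :: nat
  show "(\<lambda>x. G (of_int \<lfloor>fst x * real (Suc n)\<rfloor> / real (Suc n)) (snd x)) \<in> borel_measurable (lborel \<Otimes>\<^sub>M N)"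
  proof (rule measurable_compose_countable[where f = "\<lambda>k x. G (of_int k / real (Suc n)) (snd x)"])
    show "(\<lambda>x. G (of_int k / real (Suc n)) (snd x)) \<in> borel_measurable (lborel \<Otimes>\<^sub>M N)" for k :: int
      using measurable_compose[OF measurable_snd meas] .
  qed measurable
next
  fix x :: "real \<times> 'b" assume "x \<in> space (lborel \<Otimes>\<^sub>M N)"
  then have y: "snd x \<in> space N"
    by (auto simp: space_pair_measure)
  have "(\<lambda>n. of_int \<lfloor>fst x * real (Suc n)\<rfloor> / real (Suc n) - fst x) \<longlonglongrightarrow> 0"
  proof (rule Lim_transform_bound)
    show "(\<lambda>n. 1 / real (Suc n)) \<longlonglongrightarrow> 0"
      by (rule LIMSEQ_Suc[OF lim_1_over_n])
    have close: "norm (of_int \<lfloor>t * m\<rfloor> / m - t) \<le> norm (1 / m)" if "m > 0" for t m :: real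
    proof -
      have "of_int \<lfloor>t * m\<rfloor> / m - t = (of_int \<lfloor>t * m\<rfloor> - t * m) / m"
        using that by (simp add: diff_divide_distrib)
      moreover have "\<bar>of_int \<lfloor>t * m\<rfloor> - t * m\<bar> \<le> 1"
        by linarith
      ultimately show ?thesis
        using that by (simp add: abs_divide divide_right_mono)
    qed
    show "eventually (\<lambda>n. norm (of_int \<lfloor>fst x * real (Suc n)\<rfloor> / real (Suc n) - fst x) \<le> norm (1 / real (Suc n))) sequentially"
      by (intro always_eventually allI close) simp
  qed
  then have "(\<lambda>n. of_int \<lfloor>fst x * real (Suc n)\<rfloor> / real (Suc n)) \<longlonglongrightarrow> fst x"
    by (rule LIM_zero_cancel)
  moreover have "isCont (\<lambda>t. G t (snd x)) (fst x)"
    using cont[OF y] by (simp add: continuous_on_eq_continuous_at)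
  ultimately show "(\<lambda>n. G (of_int \<lfloor>fst x * real (Suc n)\<rfloor> / real (Suc n)) (snd x)) \<longlonglongrightarrow> G (fst x) (snd x)"
    by (rule isCont_tendsto_compose[rotated])
qed

text \<open>A derivative that exists everywhere need not be Lebesgue integrable, but its gauge
  integral is always \<open>u 1 - u 0\<close>. Changing it to 0 on the null set where the bound
  fails keeps the integral and makes the bound hold at every point.\<close>

lemma norm_diff_le_AE_bounded_derivative:
  fixes u :: "real \<Rightarrow> 'b::banach"
  assumes deriv: "\<And>t. t \<in> {0..1} \<Longrightarrow> (u has_vector_derivative u' t) (at t within {0..1})"
    and bound: "AE t in lborel. t \<in> {0..1} \<longrightarrow> norm (u' t) \<le> C" and "0 \<le> C"
  shows "norm (u 1 - u 0) \<le> C"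
proof -
  obtain S where S: "S \<in> null_sets lborel" "{t\<in>space lborel. \<not> (t \<in> {0..1} \<longrightarrow> norm (u' t) \<le> C)} \<subseteq> S"
    using bound by (auto elim!: AE_E simp: null_sets_def)
  have "(u' has_integral (u 1 - u 0)) {0..1}"
    by (rule fundamental_theorem_of_calculus) (auto intro: deriv)
  then have "((\<lambda>t. if t \<in> S then 0 else u' t) has_integral (u 1 - u 0)) {0..1}"
    by (rule has_integral_spike[of S, rotated 2])
       (use S in \<open>auto simp: negligible_iff_null_sets intro: null_sets_completionI\<close>)
  then have "norm (u 1 - u 0) \<le> C * measure lborel {0..1::real}"
    by (rule has_integral_bound_real[OF \<open>0 \<le> C\<close> finite.emptyI]) (use S \<open>0 \<le> C\<close> in auto)
  then show ?thesis
    by simp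
qed

text \<open>Fubini's theorem turns a bound valid for each \<open>t\<close> at almost every
  \<open>y\<close> into one valid for almost every \<open>y\<close> at almost every
  \<open>t\<close>; the one-variable estimate then applies. As \<open>g'\<close> is not known to be
  jointly measurable, a measurable version \<open>L\<close> stands in for it.\<close>

lemma (in sigma_finite_measure) AE_abs_diff_le_AE_bounded_derivative:
  fixes g g' :: "real \<Rightarrow> 'a \<Rightarrow> real"
  assumes meas: "\<And>t. t \<in> {0..1} \<Longrightarrow> g t \<in> borel_measurable M"
    and deriv: "AE y in M. \<forall>t\<in>{0..1}. ((\<lambda>s. g s y) has_real_derivative g' t y) (at t within {0..1})"
    and h [measurable]: "h \<in> borel_measurable M"
    and bound: "\<And>t. t \<in> {0..1} \<Longrightarrow> AE y in M. \<bar>g' t y\<bar> \<le> h y"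
  shows "AE y in M. \<bar>g 1 y - g 0 y\<bar> \<le> h y"
proof -
  interpret P: pair_sigma_finite lborel M ..
  obtain N where N: "N \<in> null_sets M"
    and deriv_all: "\<And>y. y \<in> space M - N \<Longrightarrow>
      \<forall>t\<in>{0..1}. ((\<lambda>s. g s y) has_real_derivative g' t y) (at t within {0..1})"
    by (rule AE_E3[OF deriv]) (rule that)
  then have deriv': "((\<lambda>s. g s y) has_real_derivative g' t y) (at t within {0..1})"
    if "y \<in> space M - N" "t \<in> {0..1}" for y t
    using that by blast
  have [measurable]: "N \<in> sets M"
    using N by auto
  \<comment> \<open>Clamping to the unit interval extends the functions of \<open>t\<close>
    continuously to the whole line, so that shifted arguments \<open>t + 1 / Suc n\<close> make
    sense.\<close>
  define c :: "real \<Rightarrow> real" where "c t = max 0 (min 1 t)" for t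
  have c: "c t \<in> {0..1}" for t
    by (auto simp: c_def)
  \<comment> \<open>The value 0 on \<open>N\<close> gives continuity in \<open>t\<close> at every
    \<open>y\<close> of the space, not only at almost every one.\<close>
  define G where "G t y = (if y \<in> N then 0 else g (c t) y)" for t y
  have G_joint: "(\<lambda>x. G (fst x) (snd x)) \<in> borel_measurable (lborel \<Otimes>\<^sub>M M)"
  proof (rule borel_measurable_Caratheodory)
    show "G t \<in> borel_measurable M" for t
      unfolding G_def using meas[OF c, measurable] by measurable
  next
    fix y assume y: "y \<in> space M"
    show "continuous_on UNIV (\<lambda>t. G t y)"
    proof (cases "y \<in> N")
      case False
      have "continuous_on {0..1} (\<lambda>s. g s y)"
        using deriv' y False by (intro DERIV_continuous_on[where D = "\<lambda>t. g' t y"]) auto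
      moreover have "continuous_on UNIV c"
        unfolding c_def by (intro continuous_intros)
      ultimately have "continuous_on UNIV (\<lambda>t. g (c t) y)"
        by (rule continuous_on_compose2) (use c in auto)
      then show ?thesis
        using False by (simp add: G_def)
    qed (simp add: G_def)
  qed
  \<comment> \<open>A limit of difference quotients of \<open>G\<close> is jointly measurable. It
    agrees with \<open>g'\<close> for \<open>t\<close> in the open interval and \<open>y\<close> off
    \<open>N\<close>; elsewhere its value is immaterial.\<close>
  define L where "L t y = lim (\<lambda>n. real (Suc n) * (G (t + 1 / real (Suc n)) y - G t y))" for t y
  have L_joint [measurable]: "(\<lambda>x. L (fst x) (snd x)) \<in> borel_measurable (lborel \<Otimes>\<^sub>M M)"
  proof -
    have "(\<lambda>x. G (fst x + 1 / real (Suc n)) (snd x)) \<in> borel_measurable (lborel \<Otimes>\<^sub>M M)" for n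
      using measurable_compose[OF _ G_joint, of "\<lambda>x. (fst x + 1 / real (Suc n), snd x)" "lborel \<Otimes>\<^sub>M M"]
      by simp
    then show ?thesis
      unfolding L_def using G_joint by (intro borel_measurable_lim_metric borel_measurable_times borel_measurable_diff) auto
  qed
  have L: "L t y = g' t y" if t: "0 < t" "t < 1" and y: "y \<in> space M - N" for t y
  proof -
    have "((\<lambda>s. g s y) has_real_derivative g' t y) (at t within {0..1})"
      using deriv'[OF y, of t] t by auto
    then have "((\<lambda>s. g s y) has_real_derivative g' t y) (at t)"
      using t by (simp add: at_within_Icc_at)
    then have "((\<lambda>d. (g (t + d) y - g t y) / d) \<longlongrightarrow> g' t y) (at 0)"
      by (simp add: DERIV_def)
    moreover have "filterlim (\<lambda>n. 1 / real (Suc n)) (at 0) sequentially"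
      using LIMSEQ_Suc[OF lim_1_over_n[where 'a=real]] by (auto simp: filterlim_at)
    ultimately have "(\<lambda>n. (g (t + 1 / real (Suc n)) y - g t y) / (1 / real (Suc n))) \<longlonglongrightarrow> g' t y"
      by (rule filterlim_compose)
    \<comment> \<open>Once \<open>t + 1 / Suc n\<close> is below 1, the clamping has no
      effect.\<close>
    moreover have "eventually (\<lambda>n. 1 / real (Suc n) < 1 - t) sequentially"
      using order_tendstoD(2)[OF LIMSEQ_Suc[OF lim_1_over_n[where 'a=real]], of "1 - t"] t by simp
    then have "eventually (\<lambda>n. (g (t + 1 / real (Suc n)) y - g t y) / (1 / real (Suc n)) =
        real (Suc n) * (G (t + 1 / real (Suc n)) y - G t y)) sequentially"
    proof eventually_elim
      case (elim n)
      then have "c (t + 1 / real (Suc n)) = t + 1 / real (Suc n)" "c t = t"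
        using t by (auto simp: c_def max_def min_def)
      then show ?case
        using y by (simp add: G_def)
    qed
    ultimately have "(\<lambda>n. real (Suc n) * (G (t + 1 / real (Suc n)) y - G t y)) \<longlonglongrightarrow> g' t y"
      by (rule Lim_transform_eventually)
    then show ?thesis
      unfolding L_def by (rule limI)
  qed
  \<comment> \<open>The inner statement holds for every \<open>t\<close>, since inside the open
    interval \<open>L t\<close> and \<open>g' t\<close> differ at most on \<open>N\<close>.\<close>
  have "AE t in lborel. AE y in M. t \<in> {0<..<1} \<longrightarrow> \<bar>L t y\<bar> \<le> h y"
  proof (rule AE_I2)
    fix t :: real
    show "AE y in M. t \<in> {0<..<1} \<longrightarrow> \<bar>L t y\<bar> \<le> h y"
    proof (cases "t \<in> {0<..<1}")
      case True
      then have "AE y in M. \<bar>g' t y\<bar> \<le> h y"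
        by (intro bound) auto
      then show ?thesis
        using AE_not_in[OF N] AE_space by eventually_elim (auto simp: L)
    qed auto
  qed
  then have "AE y in M. AE t in lborel. t \<in> {0<..<1} \<longrightarrow> \<bar>L t y\<bar> \<le> h y"
    by (subst (asm) P.AE_commute) measurable
  \<comment> \<open>\<open>h y\<close> will serve as the constant \<open>C\<close>, which must be
    nonnegative.\<close>
  moreover have "AE y in M. 0 \<le> h y"
    using bound[of 0] by (auto elim!: eventually_mono)
  ultimately show ?thesis
    using AE_not_in[OF N] AE_space
  proof eventually_elim
    case (elim y)
    \<comment> \<open>The endpoints, where \<open>L\<close> need not equal \<open>g'\<close>, form a
      null set.\<close>
    have "AE t in lborel. t \<in> {0..1} \<longrightarrow> norm (g' t y) \<le> h y"
      using elim(1) AE_lborel_singleton[of 0] AE_lborel_singleton[of 1]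
      by eventually_elim (use elim L in \<open>auto simp: less_le\<close>)
    then have "norm (g 1 y - g 0 y) \<le> h y"
    proof (rule norm_diff_le_AE_bounded_derivative[rotated])
      show "((\<lambda>s. g s y) has_vector_derivative g' t y) (at t within {0..1})" if "t \<in> {0..1}" for t
        using deriv'[of y t] elim that by (simp add: has_real_derivative_iff_has_vector_derivative)
    qed (use elim in simp)
    then show ?case
      by simp
  qed
qed

section \<open>Measurability of the gradient\<close>

text \<open>The preimages of an open set under \<open>l\<close> and under the measurable pointwise
  \<open>lim\<close> differ only by a null set, and completeness makes the former measurable
  too.\<close>

lemma (in complete_measure) borel_measurable_AE_LIMSEQ:
  fixes u :: "nat \<Rightarrow> 'a \<Rightarrow> real"
  assumes [measurable]: "\<And>n. u n \<in> borel_measurable M"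
    and lim: "AE x in M. (\<lambda>n. u n x) \<longlonglongrightarrow> l x"
  shows "l \<in> borel_measurable M"
proof (rule borel_measurableI)
  fix S :: "real set" assume [measurable]: "open S"
  have "(\<lambda>x. lim (\<lambda>n. u n x)) \<in> borel_measurable M"
    by measurable
  then have "(\<lambda>x. lim (\<lambda>n. u n x)) -` S \<inter> space M \<in> sets M"
    by (rule measurable_sets) simp
  then show "l -` S \<inter> space M \<in> sets M"
    using lim by (intro in_sets_AE[of "(\<lambda>x. lim (\<lambda>n. u n x)) -` S \<inter> space M" "l -` S \<inter> space M"])
      (auto simp: limI elim!: eventually_mono)
qed


text \<open>For each direction \<open>b\<close>, the component \<open>grad y \<bullet> b\<close> is
  almost everywhere a limit of measurable difference quotients in that direction.\<close>

lemma (in complete_measure) borel_measurable_gradient: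
  fixes f :: "'b::euclidean_space \<Rightarrow> 'a \<Rightarrow> real"
  assumes X: "open X" "p \<in> X"
    and meas: "\<And>q. q \<in> X \<Longrightarrow> f q \<in> borel_measurable M"
    and grad: "AE y in M. GDERIV (\<lambda>q. f q y) p :> grad y"
  shows "grad \<in> borel_measurable M"
proof -
  have "(\<lambda>y. grad y \<bullet> b) \<in> borel_measurable M" for b
  proof (rule borel_measurable_AE_LIMSEQ)
    define q where "q n = p + (1 / real (Suc n)) *\<^sub>R b" for n
    \<comment> \<open>Measurability of \<open>f q\<close> is known only for
      \<open>q \<in> X\<close>, so early points outside \<open>X\<close> are replaced by
      \<open>p\<close>; the limit is unaffected.\<close>
    define r where "r n = (if q n \<in> X then q n else p)" for n
    show "(\<lambda>y. real (Suc n) * (f (r n) y - f p y)) \<in> borel_measurable M" for n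
      using X by (intro borel_measurable_times borel_measurable_diff meas) (auto simp: r_def)
    have one: "(\<lambda>n. 1 / real (Suc n)) \<longlonglongrightarrow> 0"
      by (rule LIMSEQ_Suc[OF lim_1_over_n])
    have "q \<longlonglongrightarrow> p + 0 *\<^sub>R b"
      unfolding q_def by (intro tendsto_intros one)
    then have q: "eventually (\<lambda>n. q n \<in> X) sequentially"
      using X by (auto dest: topological_tendstoD)
    show "AE y in M. (\<lambda>n. real (Suc n) * (f (r n) y - f p y)) \<longlonglongrightarrow> grad y \<bullet> b"
      using grad
    proof eventually_elim
      case (elim y)
      have "((\<lambda>q. f q y) has_derivative (\<lambda>v. v \<bullet> grad y)) (at (p + 0 *\<^sub>R b))"
        using elim by (simp add: gderiv_def inner_commute)
      then have "((\<lambda>t. f (p + t *\<^sub>R b) y) has_derivative (\<lambda>t. (t *\<^sub>R b) \<bullet> grad y)) (at 0)"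
        by (rule has_derivative_compose[rotated]) (auto intro!: derivative_eq_intros)
      then have "((\<lambda>t. f (p + t *\<^sub>R b) y) has_real_derivative grad y \<bullet> b) (at 0)"
        by (simp add: has_field_derivative_def inner_commute mult_commute_abs)
      then have "((\<lambda>t. (f (p + t *\<^sub>R b) y - f p y) / t) \<longlongrightarrow> grad y \<bullet> b) (at 0)"
        by (simp add: DERIV_def)
      moreover have "filterlim (\<lambda>n. 1 / real (Suc n)) (at 0) sequentially"
        using one by (auto simp: filterlim_at)
      ultimately have "(\<lambda>n. (f (q n) y - f p y) / (1 / real (Suc n))) \<longlonglongrightarrow> grad y \<bullet> b"
        unfolding q_def by (rule filterlim_compose)
      moreover have "eventually (\<lambda>n. (f (q n) y - f p y) / (1 / real (Suc n)) =
          real (Suc n) * (f (r n) y - f p y)) sequentially"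
        using q by eventually_elim (simp add: r_def)
      ultimately show ?case
        by (rule Lim_transform_eventually)
    qed
  qed
  then show ?thesis
    by (subst borel_measurable_euclidean_space) auto
qed

section \<open>Differentiation under the integral sign\<close>

text \<open>The first-order remainder divided by \<open>norm (q - p)\<close> tends to 0 for almost
  every \<open>y\<close> and is dominated by \<open>2 * h\<close>, so its integral tends to
  0.\<close>

lemma (in sigma_finite_measure) GDERIV_integral:
  fixes f :: "'b::euclidean_space \<Rightarrow> 'a \<Rightarrow> real"
  assumes X: "open X" "p \<in> X"
    and f: "\<And>q. q \<in> X \<Longrightarrow> integrable M (f q)"
    and grad: "AE y in M. \<forall>q\<in>X. GDERIV (\<lambda>q. f q y) q :> grad q y"
    and grad_meas [measurable]: "grad p \<in> borel_measurable M"
    and h: "integrable M h"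
    and bound: "\<And>q. q \<in> X \<Longrightarrow> AE y in M. norm (grad q y) \<le> h y"
  shows "integrable M (grad p)"
    and "GDERIV (\<lambda>q. LINT y|M. f q y) p :> (LINT y|M. grad p y)"
proof -
  show int: "integrable M (grad p)"
    by (rule Bochner_Integration.integrable_bound[OF h grad_meas])
       (use bound[OF X(2)] in \<open>auto elim!: eventually_mono\<close>)
  \<comment> \<open>A ball contains the segment from \<open>p\<close> to each of its points, whereas
    \<open>X\<close> need not be convex.\<close>
  obtain e where e: "e > 0" "ball p e \<subseteq> X"
    using X by (auto simp: open_contains_ball)
  \<comment> \<open>Along the segment \<open>z\<close>, the chain rule and Cauchy-Schwarz bound the
    derivative by \<open>norm (q - p) * h y\<close>. The exceptional null set may depend on
    \<open>q\<close>.\<close>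
  have lip: "AE y in M. \<bar>f q y - f p y\<bar> \<le> norm (q - p) * h y" if q: "q \<in> ball p e" for q
  proof -
    define z where "z t = p + t *\<^sub>R (q - p)" for t :: real
    have z: "z t \<in> X" if "t \<in> {0..1}" for t
    proof -
      have "\<bar>t\<bar> * norm (q - p) \<le> 1 * norm (q - p)"
        using that by (intro mult_right_mono) auto
      then have "z t \<in> ball p e"
        using q by (simp add: z_def dist_norm norm_minus_commute)
      then show ?thesis
        using e by auto
    qed
    have "AE y in M. \<bar>f (z 1) y - f (z 0) y\<bar> \<le> norm (q - p) * h y"
    proof (rule AE_abs_diff_le_AE_bounded_derivative)
      show "f (z t) \<in> borel_measurable M" if "t \<in> {0..1}" for t
        using f[OF z[OF that]] by auto
      show "(\<lambda>y. norm (q - p) * h y) \<in> borel_measurable M"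
        using h by auto
      show "AE y in M. \<forall>t\<in>{0..1}. ((\<lambda>s. f (z s) y) has_real_derivative (q - p) \<bullet> grad (z t) y) (at t within {0..1})"
        using grad
      proof (eventually_elim, intro ballI)
        fix y and t :: real
        assume D: "\<forall>q\<in>X. GDERIV (\<lambda>q. f q y) q :> grad q y" and t: "t \<in> {0..1}"
        have "((\<lambda>q. f q y) has_derivative (\<lambda>v. v \<bullet> grad (z t) y)) (at (z t))"
          using D z[OF t] by (simp add: gderiv_def inner_commute)
        then have "((\<lambda>s. f (z s) y) has_derivative (\<lambda>s. (s *\<^sub>R (q - p)) \<bullet> grad (z t) y)) (at t within {0..1})"
          by (rule has_derivative_compose[rotated]) (auto simp: z_def intro!: derivative_eq_intros)
        then show "((\<lambda>s. f (z s) y) has_real_derivative (q - p) \<bullet> grad (z t) y) (at t within {0..1})"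
          by (simp add: has_field_derivative_def mult_commute_abs)
      qed
      show "AE y in M. \<bar>(q - p) \<bullet> grad (z t) y\<bar> \<le> norm (q - p) * h y" if "t \<in> {0..1}" for t
        using bound[OF z[OF that]]
      proof eventually_elim
        case (elim y)
        have "\<bar>(q - p) \<bullet> grad (z t) y\<bar> \<le> norm (q - p) * norm (grad (z t) y)"
          by (rule Cauchy_Schwarz_ineq2)
        also have "\<dots> \<le> norm (q - p) * h y"
          using elim by (intro mult_left_mono) auto
        finally show ?case .
      qed
    qed
    then show ?thesis
      by (simp add: z_def)
  qed
  let ?R = "\<lambda>q y. (f q y - f p y - grad p y \<bullet> (q - p)) / norm (q - p)"
  let ?I = "\<lambda>q. LINT y|M. f q y"
  have "((\<lambda>q. (?I q - ?I p - (LINT y|M. grad p y) \<bullet> (q - p)) / norm (q - p)) \<longlongrightarrow> 0) (at p within ball p e)"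
    \<comment> \<open>Dominated convergence works along sequences and needs the bound almost
      everywhere for each term separately, so null sets depending on the point do no harm.\<close>
    unfolding tendsto_at_iff_sequentially
  proof (intro allI impI)
    fix r assume r: "\<forall>n. r n \<in> ball p e - {p}" "r \<longlonglongrightarrow> p"
    then have r_ball: "r n \<in> ball p e" for n
      by auto
    then have rX: "r n \<in> X" for n
      using e by blast
    have "(\<lambda>n. LINT y|M. ?R (r n) y) \<longlonglongrightarrow> (LINT y|M. 0)"
    proof (rule integral_dominated_convergence[where w = "\<lambda>y. 2 * h y"])
      show "?R (r n) \<in> borel_measurable M" for n
        using f[OF rX] f[OF X(2)] by measurable
      show "AE y in M. (\<lambda>n. ?R (r n) y) \<longlonglongrightarrow> 0"
        using grad
      proof eventually_elim
        case (elim y)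
        then have "((\<lambda>q. f q y) has_derivative (\<lambda>v. grad p y \<bullet> v)) (at p)"
          using X by (auto simp: gderiv_def inner_commute)
        then have "((\<lambda>q. norm (?R q y)) \<longlongrightarrow> 0) (at p)"
          by (simp add: has_derivative_iff_norm abs_divide)
        then have "((\<lambda>q. ?R q y) \<longlongrightarrow> 0) (at p)"
          by (rule tendsto_norm_zero_cancel)
        then show ?case
          using r unfolding tendsto_at_iff_sequentially by (auto simp: comp_def)
      qed
      \<comment> \<open>One \<open>h y\<close> bounds the increment of \<open>f\<close>, the other
        the linear term.\<close>
      show "AE y in M. norm (?R (r n) y) \<le> 2 * h y" for n
        using lip[OF r_ball[of n]] bound[OF X(2)]
      proof eventually_elim
        case (elim y)
        have pos: "norm (r n - p) > 0"
          using r by auto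
        have "\<bar>grad p y \<bullet> (r n - p)\<bar> \<le> norm (grad p y) * norm (r n - p)"
          by (rule Cauchy_Schwarz_ineq2)
        also have "\<dots> \<le> h y * norm (r n - p)"
          using elim by (intro mult_right_mono) auto
        finally have "\<bar>f (r n) y - f p y - grad p y \<bullet> (r n - p)\<bar> \<le> 2 * h y * norm (r n - p)"
          using elim(1) by (simp only: mult.commute[of "norm (r n - p)" "h y"])
        then show ?case
          using pos by (simp add: pos_divide_le_eq)
      qed
    qed (use h in auto)
    moreover have "(LINT y|M. f q y - f p y - grad p y \<bullet> (q - p)) = ?I q - ?I p - (LINT y|M. grad p y) \<bullet> (q - p)"
      if "q \<in> X" for q
      using f[OF that] f[OF X(2)] int by simp
    ultimately show "((\<lambda>q. (?I q - ?I p - (LINT y|M. grad p y) \<bullet> (q - p)) / norm (q - p)) \<circ> r) \<longlonglongrightarrow> 0"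
      using rX by (simp add: comp_def)
  qed
  moreover have "at p within ball p e = at p"
    using e by (intro at_within_open) auto
  ultimately have "((\<lambda>q. norm ((?I q - ?I p - (q - p) \<bullet> (LINT y|M. grad p y)) / norm (q - p))) \<longlongrightarrow> 0) (at p)"
    by (simp only: inner_commute tendsto_norm_zero)
  then show "GDERIV ?I p :> (LINT y|M. grad p y)"
    unfolding gderiv_def has_derivative_iff_norm
    by (simp only: real_norm_def abs_divide abs_norm_cancel bounded_linear_inner_left simp_thms)
qed

section \<open>The sphere measure, the softmax weights and coordinates\<close>

lemma complete_sphere_measure: "complete_measure sphere_measure"
  unfolding sphere_measure_def by unfold_locales

text \<open>The cone over the whole sphere lies in the unit ball, which has finite volume.
  Finiteness supplies the sigma-finiteness behind Fubini's theorem.\<close>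

lemma finite_sphere_measure: "finite_measure (sphere_measure :: 'a::euclidean_space measure)"
proof (rule finite_measureI)
  have "emeasure lborel {x::'a. 0 < norm x \<and> norm x < 1 \<and> x /\<^sub>R norm x \<in> sphere 0 1} \<le> emeasure lborel (ball (0::'a) 1)"
    by (rule emeasure_mono) auto
  also have "\<dots> < \<infinity>"
    by (rule emeasure_bounded_finite) simp
  finally show "emeasure (sphere_measure :: 'a measure) (space sphere_measure) \<noteq> \<infinity>"
    by (simp add: space_sphere_measure emeasure_sphere_measure ennreal_mult_eq_top_iff)
qed

lemma borel_measurable_sphere_measure:
  assumes "g \<in> borel_measurable borel"
  shows "g \<in> borel_measurable sphere_measure"
  unfolding sphere_measure_def
  by (rule measurable_completion)
     (use measurable_restrict_space1[OF assms] in \<open>simp cong: measurable_cong_sets\<close>)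

lemma softmax_weight_measurable: "softmax_weight D \<epsilon> i \<in> borel_measurable borel"
  unfolding softmax_weight_def by measurable

text \<open>These bounds let the weighted signal inherit integrability from \<open>f\<close>, and
  the weighted gradient the bound \<open>h\<close>.\<close>

lemma softmax_weight_bounds: "0 \<le> softmax_weight D \<epsilon> i \<theta>" "softmax_weight D \<epsilon> i \<theta> \<le> 1"
proof -
  have "exp (\<theta> \<bullet> D i / \<epsilon>) \<le> (\<Sum>j\<in>UNIV. exp (\<theta> \<bullet> D j / \<epsilon>))"
    by (rule member_le_sum) auto
  then show "0 \<le> softmax_weight D \<epsilon> i \<theta>" "softmax_weight D \<epsilon> i \<theta> \<le> 1"
    by (auto simp: softmax_weight_def sum_nonneg divide_le_eq_1 intro!: sum_pos)
qed

text \<open>Integrals and derivatives of vectors and matrices reduce to those of their entries or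
  rows, because both commute with finite sums and with the bounded linear maps
  \<open>axis i\<close>.\<close>

lemma vec_lambda_eq_sum_axis: "(\<chi> i. x i) = (\<Sum>i\<in>UNIV. axis i (x i))"
  by (simp add: vec_eq_iff axis_def if_distrib[of "\<lambda>f. f _"] cong: if_cong)

text \<open>The entry type stays general: \<open>axis i\<close> embeds the real entries of the
  feature map as well as the rows of its Jacobian.\<close>

lemma bounded_linear_axis: "bounded_linear (axis i :: 'a::real_normed_vector \<Rightarrow> 'a ^ 'n)"
proof (rule bounded_linear_intro[where K = 1])
  show "norm (axis i x :: 'a ^ 'n) \<le> norm x * 1" for x
    by (simp add: norm_vec_def L2_set_def axis_def if_distrib[of norm] if_distrib[of "\<lambda>x. x\<^sup>2"] cong: if_cong)
qed (simp_all add: vec_eq_iff axis_def)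

section \<open>Gradients of the features and Jacobian of the feature map\<close>

theorem proposition18:
  fixes M :: "(real ^ 'd) set"
    and D :: "'n::finite \<Rightarrow> real ^ 'd"
    and \<epsilon> :: real
    and f :: "real ^ 'd \<Rightarrow> real ^ 'd \<Rightarrow> real"
    and grad_f :: "real ^ 'd \<Rightarrow> real ^ 'd \<Rightarrow> real ^ 'd"
    and h :: "real ^ 'd \<Rightarrow> real"
  assumes dim: "CARD('d) \<in> {2, 3}"
    and M: "open M"
    and basis: "directional_basis D"
    and temperature: "\<epsilon> > 0"
    and integrable_f: "\<And>p. p \<in> M \<Longrightarrow> integrable sphere_measure (f p)"
    and D1: "AE \<theta> in sphere_measure. \<forall>p\<in>M. GDERIV (\<lambda>q. f q \<theta>) p :> grad_f p \<theta>"
    and D2: "integrable sphere_measure h"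
      "\<And>p. p \<in> M \<Longrightarrow> AE \<theta> in sphere_measure. norm (grad_f p \<theta>) \<le> h \<theta>"
  shows "(\<forall>i. \<forall>p\<in>M.
            integrable sphere_measure (\<lambda>\<theta>. softmax_weight D \<epsilon> i \<theta> *\<^sub>R grad_f p \<theta>) \<and>
            GDERIV (feature_component D \<epsilon> f i) p :>
              (LINT \<theta>|sphere_measure. softmax_weight D \<epsilon> i \<theta> *\<^sub>R grad_f p \<theta>)) \<and>
         (\<forall>p\<in>M.
            integrable sphere_measure
              (\<lambda>\<theta>. outer_product (softmax_weights D \<epsilon> \<theta>) (grad_f p \<theta>)) \<and>
            feature_map D \<epsilon> f differentiable (at p) \<and>
            jacobian (feature_map D \<epsilon> f) (at p) =
              (LINT \<theta>|sphere_measure. outer_product (softmax_weights D \<epsilon> \<theta>) (grad_f p \<theta>)))"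
proof -
  interpret S: complete_measure "sphere_measure :: (real ^ 'd) measure"
    by (rule complete_sphere_measure)
  interpret S: finite_measure "sphere_measure :: (real ^ 'd) measure"
    by (rule finite_sphere_measure)
  let ?w = "softmax_weight D \<epsilon>"
  let ?v = "\<lambda>i p \<theta>. ?w i \<theta> *\<^sub>R grad_f p \<theta>"
  have w [measurable]: "?w i \<in> borel_measurable sphere_measure" for i
    by (intro borel_measurable_sphere_measure softmax_weight_measurable)
  have component: "integrable sphere_measure (?v i p)"
      "GDERIV (feature_component D \<epsilon> f i) p :> (LINT \<theta>|sphere_measure. ?v i p \<theta>)"
    if p: "p \<in> M" for i p
  proof -
    have fw: "integrable sphere_measure (\<lambda>\<theta>. f q \<theta> * ?w i \<theta>)" if q: "q \<in> M" for q
    proof (rule Bochner_Integration.integrable_bound[OF integrable_f[OF q]])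
      show "(\<lambda>\<theta>. f q \<theta> * ?w i \<theta>) \<in> borel_measurable sphere_measure"
        using integrable_f[OF q] by measurable
      show "AE \<theta> in sphere_measure. norm (f q \<theta> * ?w i \<theta>) \<le> norm (f q \<theta>)"
        by (simp add: abs_mult softmax_weight_bounds mult_left_le)
    qed
    \<comment> \<open>The weight does not depend on \<open>q\<close>, so only one term of the
      product rule survives.\<close>
    have deriv: "AE \<theta> in sphere_measure. \<forall>q\<in>M. GDERIV (\<lambda>q. f q \<theta> * ?w i \<theta>) q :> ?v i q \<theta>"
      using D1
    proof (eventually_elim, intro ballI)
      fix \<theta> q assume "\<forall>p\<in>M. GDERIV (\<lambda>q. f q \<theta>) p :> grad_f p \<theta>" "q \<in> M"
      then show "GDERIV (\<lambda>q. f q \<theta> * ?w i \<theta>) q :> ?v i q \<theta>"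
        using GDERIV_mult[OF _ GDERIV_const, of "\<lambda>q. f q \<theta>" q] by auto
    qed
    \<comment> \<open>This is where completeness of the sphere measure enters.\<close>
    have meas: "?v i p \<in> borel_measurable sphere_measure"
      using fw deriv p
      by (intro S.borel_measurable_gradient[OF M p, of "\<lambda>q \<theta>. f q \<theta> * ?w i \<theta>"])
         (auto elim!: eventually_mono)
    have bound: "AE \<theta> in sphere_measure. norm (?v i q \<theta>) \<le> h \<theta>" if "q \<in> M" for q
      using D2(2)[OF that]
    proof eventually_elim
      case (elim \<theta>)
      have "norm (?v i q \<theta>) \<le> norm (grad_f q \<theta>)"
        by (simp add: softmax_weight_bounds mult_left_le_one_le)
      with elim show ?case
        by simp
    qed
    show "integrable sphere_measure (?v i p)"
      "GDERIV (feature_component D \<epsilon> f i) p :> (LINT \<theta>|sphere_measure. ?v i p \<theta>)"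
      using S.GDERIV_integral[OF M p fw deriv meas D2(1) bound]
      unfolding feature_component_def by auto
  qed
  have outer: "outer_product (softmax_weights D \<epsilon> \<theta>) (grad_f p \<theta>) = (\<Sum>i\<in>UNIV. axis i (?v i p \<theta>))" for p \<theta>
    unfolding vec_lambda_eq_sum_axis[symmetric]
    by (simp add: outer_product_def softmax_weights_def vec_eq_iff)
  have jac: "integrable sphere_measure (\<lambda>\<theta>. outer_product (softmax_weights D \<epsilon> \<theta>) (grad_f p \<theta>))"
      "(LINT \<theta>|sphere_measure. outer_product (softmax_weights D \<epsilon> \<theta>) (grad_f p \<theta>)) =
        (\<chi> i. LINT \<theta>|sphere_measure. ?v i p \<theta>)"
      "(feature_map D \<epsilon> f has_derivative (*v) (\<chi> i. LINT \<theta>|sphere_measure. ?v i p \<theta>)) (at p)"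
    if p: "p \<in> M" for p
  proof -
    have ax: "integrable sphere_measure (\<lambda>\<theta>. axis i (?v i p \<theta>) :: real ^ 'd ^ 'n)" for i
      by (rule integrable_bounded_linear[OF bounded_linear_axis component(1)[OF p]])
    show "integrable sphere_measure (\<lambda>\<theta>. outer_product (softmax_weights D \<epsilon> \<theta>) (grad_f p \<theta>))"
      unfolding outer by (intro Bochner_Integration.integrable_sum ax)
    show "(LINT \<theta>|sphere_measure. outer_product (softmax_weights D \<epsilon> \<theta>) (grad_f p \<theta>)) =
        (\<chi> i. LINT \<theta>|sphere_measure. ?v i p \<theta>)"
      unfolding outer vec_lambda_eq_sum_axis
      by (simp add: Bochner_Integration.integral_sum ax
          integral_bounded_linear[OF bounded_linear_axis component(1)[OF p]])
    have "((\<lambda>q. \<Sum>i\<in>UNIV. axis i (feature_component D \<epsilon> f i q) :: real ^ 'n) has_derivative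
        (\<lambda>x. \<Sum>i\<in>UNIV. axis i (x \<bullet> (LINT \<theta>|sphere_measure. ?v i p \<theta>)))) (at p)"
      using component(2)[OF p] unfolding gderiv_def
      by (intro has_derivative_sum bounded_linear.has_derivative[OF bounded_linear_axis])
    moreover have "(\<lambda>x. \<Sum>i\<in>UNIV. axis i (x \<bullet> (LINT \<theta>|sphere_measure. ?v i p \<theta>))) =
        (*v) (\<chi> i. LINT \<theta>|sphere_measure. ?v i p \<theta>)"
      unfolding vec_lambda_eq_sum_axis[symmetric]
      by (rule ext) (simp add: matrix_vector_mult_def inner_vec_def mult.commute)
    ultimately show "(feature_map D \<epsilon> f has_derivative (*v) (\<chi> i. LINT \<theta>|sphere_measure. ?v i p \<theta>)) (at p)"
      by (simp add: feature_map_def[abs_def] vec_lambda_eq_sum_axis)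
  qed
  \<comment> \<open>By uniqueness of the Fr\<e>chet derivative, its matrix is the one whose rows are
    the component gradients.\<close>
  have "jacobian (feature_map D \<epsilon> f) (at p) =
      (LINT \<theta>|sphere_measure. outer_product (softmax_weights D \<epsilon> \<theta>) (grad_f p \<theta>))" if p: "p \<in> M" for p
    unfolding jac(2)[OF p] jacobian_def frechet_derivative_at[OF jac(3)[OF p], symmetric]
    by (rule matrix_of_matrix_vector_mul)
  then show ?thesis
    using component jac(1,3) unfolding differentiable_def by blast
qed

end
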